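(* Let $X$ be a metric space and $\ell\in \mathbb{R}_{\geq 0}$. Tajima and Yoshinaga's magnitude homotopy type $\mathcal{M}^\ell(X)$ is homeomorphic to the geometric realization $|\mathsf{M}^\ell_\bullet(X)|$ of Hepworth and Willerton's simplicial set $\mathsf{M}^\ell_\bullet(X)$.
   Context: Tajima–Yoshinaga construction. For $a,b\in X$ let $\mathrm{Cau}^\ell(X;a,b)=\{(x,t)\in X\times[0,\ell]\mid d(a,x)\le t,\ d(x,b)\le \ell-t\}$, partially ordered by $(x,t)\le(x',t')$ iff $d(x,x')\le t'-t$, and let $\mathrm{Cau}^\ell(X)=\coprod_{a,b\in X}\mathrm{Cau}^\ell(X;a,b)$ (disjoint union of posets). Let $\Delta\mathrm{Cau}^\ell(X)=\coprod_{a,b\in X}\Delta\mathrm{Cau}^\ell(X;a,b)$ be its order complex: the simplices of $\Delta\mathrm{Cau}^\ell(X;a,b)$ are the nonempty finite chains $\{(x_0,t_0)<\dots<(x_n,t_n)\}$ in $\mathrm{Cau}^\ell(X;a,b)$, i.e. finite sets of points with $d(x_i,x_{i+1})\le t_{i+1}-t_i$ for $-1\le i\le n$, where $x_{-1}=a$, $x_{n+1}=b$, $t_{-1}=0$, $t_{n+1}=\ell$. Let $\Delta'\mathrm{Cau}^\ell(X)=\coprod_{a,b\in X}\Delta'\mathrm{Cau}^\ell(X;a,b)$ be the subcomplex where $\Delta'\mathrm{Cau}^\ell(X;a,b)$ consists of those simplices $((x_0,t_0),\dots,(x_n,t_n))$ of $\Delta\mathrm{Cau}^\ell(X;a,b)$,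 listed in increasing order, with $\sum_{i=0}^{n-1}d(x_i,x_{i+1})<\ell$. Define the CW complex $\mathcal{M}^\ell(X)=|\Delta\mathrm{Cau}^\ell(X)|/|\Delta'\mathrm{Cau}^\ell(X)|$, the quotient of geometric realizations (with the usual convention that collapsing the empty subspace adds a disjoint base point). Hepworth–Willerton simplicial set: $\mathsf{M}^\ell_\bullet(X)$ is the pointed simplicial set with $\mathsf{M}^\ell_n(X)=\{(x_0,\dots,x_n)\in X^{n+1}\mid \sum_{i=0}^{n-1}d(x_i,x_{i+1})=\ell\}\cup\{\ast\}$ (base point $\ast$, disjoint from the tuples; consecutive entries may coincide). Face maps: $d_i(\ast)=\ast$, and $d_i(x_0,\dots,x_n)=(x_0,\dots,\hat{x}_i,\dots,x_n)$ if the tuple obtained by deleting $x_i$ still has total length $\ell$ (for $1\le i\le n-1$ this means $d(x_{i-1},x_{i+1})=d(x_{i-1},x_i)+d(x_i,x_{i+1})$; for $i=0$ it means $x_0=x_1$; for $i=n$ it means $x_{n-1}=x_n$), and $d_i(x_0,\dots,x_n)=\ast$ otherwise. Degeneracies: $s_i(\ast)=\ast$, $s_i(x_0,\dots,x_n)=(x_0,\dots,x_i,x_i,\dots,x_n)$. *)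

theory Defs
  imports "HOL-Analysis.Analysis" "HOL-Homology.Simplices"
begin

section \<open>Topological constructions\<close>

text \<open>The finest topology on \<open>S\<close> making \<open>f\<close> continuous on \<open>T\<close>. The map need not be
  onto \<open>S\<close>; points of \<open>S\<close> outside the image are isolated.\<close>

definition coinduced_topology :: "'b set \<Rightarrow> 'a topology \<Rightarrow> ('a \<Rightarrow> 'b) \<Rightarrow> 'b topology" where
  "coinduced_topology S T f =
     topology (\<lambda>U. U \<subseteq> S \<and> openin T {x \<in> topspace T. f x \<in> U})"

lemma istopology_coinduced:
  "istopology (\<lambda>U. U \<subseteq> S \<and> openin T {x \<in> topspace T. f x \<in> U})"
  unfolding istopology_def
proof (intro conjI allI impI)
  fix U V
  assume "U \<subseteq> S \<and> openin T {x \<in> topspace T. f x \<in> U}"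
    and "V \<subseteq> S \<and> openin T {x \<in> topspace T. f x \<in> V}"
  moreover have "{x \<in> topspace T. f x \<in> U \<inter> V} =
      {x \<in> topspace T. f x \<in> U} \<inter> {x \<in> topspace T. f x \<in> V}"
    by blast
  ultimately show "U \<inter> V \<subseteq> S" "openin T {x \<in> topspace T. f x \<in> U \<inter> V}"
    by auto
next
  fix \<U>
  assume *: "\<forall>U\<in>\<U>. U \<subseteq> S \<and> openin T {x \<in> topspace T. f x \<in> U}"
  then show "\<Union>\<U> \<subseteq> S"
    by blast
  have "{x \<in> topspace T. f x \<in> \<Union>\<U>} = (\<Union>U\<in>\<U>. {x \<in> topspace T. f x \<in> U})"
    by blast
  moreover have "openin T (\<Union>U\<in>\<U>. {x \<in> topspace T. f x \<in> U})"
    using * by (intro openin_Union) auto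
  ultimately show "openin T {x \<in> topspace T. f x \<in> \<Union>\<U>}"
    by (rule ssubst)
qed

lemma openin_coinduced_topology:
  "openin (coinduced_topology S T f) U \<longleftrightarrow> U \<subseteq> S \<and> openin T {x \<in> topspace T. f x \<in> U}"
  unfolding coinduced_topology_def by (simp add: istopology_coinduced)

lemma topspace_coinduced_topology:
  assumes "f ` topspace T \<subseteq> S"
  shows "topspace (coinduced_topology S T f) = S"
proof (rule antisym)
  show "topspace (coinduced_topology S T f) \<subseteq> S"
    using openin_topspace[of "coinduced_topology S T f"]
    unfolding openin_coinduced_topology by (rule conjunct1)
  have "{x \<in> topspace T. f x \<in> S} = topspace T"
    using assms by blast
  then show "S \<subseteq> topspace (coinduced_topology S T f)"
    by (intro openin_subset) (simp add: openin_coinduced_topology)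
qed

lemma quotient_map_coinduced_topology:
  "quotient_map T (coinduced_topology (f ` topspace T) T f) f"
  unfolding quotient_map_def
  by (simp add: topspace_coinduced_topology openin_coinduced_topology)

text \<open>The quotient \<open>T/A\<close>, with \<open>None\<close> the point to which \<open>A\<close> is collapsed. If \<open>A\<close> is empty,
  \<open>None\<close> is an isolated extra point, i.e. a disjoint base point.\<close>

definition collapse_topology :: "'a topology \<Rightarrow> 'a set \<Rightarrow> 'a option topology" where
  "collapse_topology T A =
     coinduced_topology (insert None (Some ` (topspace T - A))) T
       (\<lambda>x. if x \<in> A then None else Some x)"

section \<open>Abstract simplicial complexes\<close>

text \<open>A complex is given by its set of (finite, nonempty) simplices. Points of the geometric
  realization are barycentric coordinate functions on the vertices, and the topology is the weak
  (CW) topology determined by the closed simplices.\<close>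

definition closed_simplex :: "'v set \<Rightarrow> ('v \<Rightarrow> real) set" where
  "closed_simplex \<sigma> = {f. (\<forall>v. 0 \<le> f v) \<and> (\<forall>v. v \<notin> \<sigma> \<longrightarrow> f v = 0) \<and> sum f \<sigma> = 1}"

definition complex_carrier :: "'v set set \<Rightarrow> ('v \<Rightarrow> real) set" where
  "complex_carrier K = (\<Union>\<sigma>\<in>K. closed_simplex \<sigma>)"

definition complex_realization :: "'v set set \<Rightarrow> ('v \<Rightarrow> real) topology" where
  "complex_realization K =
     coinduced_topology (complex_carrier K)
       (sum_topology (\<lambda>\<sigma>. subtopology (powertop_real UNIV) (closed_simplex \<sigma>)) K) snd"

lemma openin_complex_realization:
  "openin (complex_realization K) U \<longleftrightarrow>
     U \<subseteq> complex_carrier K \<and>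
     (\<forall>\<sigma>\<in>K. openin (subtopology (powertop_real UNIV) (closed_simplex \<sigma>)) (U \<inter> closed_simplex \<sigma>))"
proof -
  define T where
    "T = sum_topology (\<lambda>\<sigma>. subtopology (powertop_real UNIV) (closed_simplex \<sigma>)) K"
  define V where "V = {x \<in> topspace T. snd x \<in> U}"
  have V: "V = {x \<in> Sigma K closed_simplex. snd x \<in> U}"
    by (simp add: V_def T_def o_def)
  have slice: "{x. (\<sigma>, x) \<in> V} = U \<inter> closed_simplex \<sigma>" if "\<sigma> \<in> K" for \<sigma>
    unfolding V using that by auto
  have "V \<subseteq> Sigma K (topspace \<circ>
      (\<lambda>\<sigma>. subtopology (powertop_real UNIV) (closed_simplex \<sigma>)))"
    unfolding V by (auto simp: o_def)
  then have "openin T V \<longleftrightarrow>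
      (\<forall>\<sigma>\<in>K. openin (subtopology (powertop_real UNIV) (closed_simplex \<sigma>)) (U \<inter> closed_simplex \<sigma>))"
    unfolding T_def openin_sum_topology using slice by (metis (no_types, lifting))
  then show ?thesis
    unfolding complex_realization_def openin_coinduced_topology V_def T_def by simp
qed

lemma topspace_complex_realization: "topspace (complex_realization K) = complex_carrier K"
  unfolding complex_realization_def
  by (rule topspace_coinduced_topology) (auto simp: complex_carrier_def)

definition coprod_complex :: "'i set \<Rightarrow> ('i \<Rightarrow> 'v set set) \<Rightarrow> ('i \<times> 'v) set set" where
  "coprod_complex I K = (\<Union>i\<in>I. (\<lambda>\<sigma>. Pair i ` \<sigma>) ` K i)"

definition order_complex :: "('v \<Rightarrow> 'v \<Rightarrow> bool) \<Rightarrow> 'v set \<Rightarrow> 'v set set" where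
  "order_complex r P =
     {\<sigma>. \<sigma> \<subseteq> P \<and> finite \<sigma> \<and> \<sigma> \<noteq> {} \<and> Complete_Partial_Order.chain r \<sigma>}"

section \<open>Simplicial sets\<close>

text \<open>\<open>face S n i\<close> maps \<open>n\<close>-simplices to \<open>(n - 1)\<close>-simplices (for \<open>1 \<le> n\<close>, \<open>i \<le> n\<close>) and
  \<open>degen S n i\<close> maps \<open>n\<close>-simplices to \<open>(n + 1)\<close>-simplices (for \<open>i \<le> n\<close>).\<close>

record 's simplicial_set =
  simplices :: "nat \<Rightarrow> 's set"
  face :: "nat \<Rightarrow> nat \<Rightarrow> 's \<Rightarrow> 's"
  degen :: "nat \<Rightarrow> nat \<Rightarrow> 's \<Rightarrow> 's"

text \<open>The codegeneracy \<open>\<Delta>\<^sup>n\<^sup>+\<^sup>1 \<rightarrow> \<Delta>\<^sup>n\<close> merging the vertices \<open>i\<close> and \<open>i + 1\<close>; the coface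
  \<open>\<Delta>\<^sup>n \<rightarrow> \<Delta>\<^sup>n\<^sup>+\<^sup>1\<close> omitting vertex \<open>i\<close> is \<^const>\<open>simplical_face\<close>.\<close>

definition simplicial_degen :: "nat \<Rightarrow> (nat \<Rightarrow> real) \<Rightarrow> nat \<Rightarrow> real" where
  "simplicial_degen i t =
     (\<lambda>j. if j < i then t j else if j = i then t i + t (Suc i) else t (Suc j))"

inductive glue ::
  "'s simplicial_set \<Rightarrow> nat \<times> 's \<times> (nat \<Rightarrow> real) \<Rightarrow> nat \<times> 's \<times> (nat \<Rightarrow> real) \<Rightarrow> bool"
  for S :: "'s simplicial_set" where
  glue_face:
    "\<lbrakk>s \<in> simplices S (Suc n); i \<le> Suc n; t \<in> standard_simplex n\<rbrakk>
     \<Longrightarrow> glue S (n, face S (Suc n) i s, t) (Suc n, s, simplical_face i t)"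
| glue_degen:
    "\<lbrakk>s \<in> simplices S n; i \<le> n; t \<in> standard_simplex (Suc n)\<rbrakk>
     \<Longrightarrow> glue S (Suc n, degen S n i s, t) (n, s, simplicial_degen i t)"

definition sset_prerealization :: "'s simplicial_set \<Rightarrow> (nat \<times> 's \<times> (nat \<Rightarrow> real)) topology" where
  "sset_prerealization S =
     sum_topology
       (\<lambda>n. prod_topology (discrete_topology (simplices S n))
              (subtopology (powertop_real UNIV) (standard_simplex n)))
       UNIV"

definition sset_realization :: "'s simplicial_set \<Rightarrow> (nat \<times> 's \<times> (nat \<Rightarrow> real)) set topology" where
  "sset_realization S =
     (let q = (\<lambda>p. {p'. equivclp (glue S) p p'})
      in coinduced_topology (q ` topspace (sset_prerealization S)) (sset_prerealization S) q)"

section \<open>The Tajima--Yoshinaga magnitude homotopy type\<close>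

definition path_length :: "('a \<Rightarrow> 'a \<Rightarrow> real) \<Rightarrow> 'a list \<Rightarrow> real" where
  "path_length d xs = (\<Sum>i<length xs - 1. d (xs ! i) (xs ! Suc i))"

definition Cau :: "'a set \<Rightarrow> ('a \<Rightarrow> 'a \<Rightarrow> real) \<Rightarrow> real \<Rightarrow> 'a \<Rightarrow> 'a \<Rightarrow> ('a \<times> real) set" where
  "Cau X d l a b = {(x, t). x \<in> X \<and> 0 \<le> t \<and> t \<le> l \<and> d a x \<le> t \<and> d x b \<le> l - t}"

definition cau_le :: "('a \<Rightarrow> 'a \<Rightarrow> real) \<Rightarrow> 'a \<times> real \<Rightarrow> 'a \<times> real \<Rightarrow> bool" where
  "cau_le d p q \<longleftrightarrow> d (fst p) (fst q) \<le> snd q - snd p"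

definition \<Delta>Cau_ab :: "'a set \<Rightarrow> ('a \<Rightarrow> 'a \<Rightarrow> real) \<Rightarrow> real \<Rightarrow> 'a \<Rightarrow> 'a \<Rightarrow> ('a \<times> real) set set" where
  "\<Delta>Cau_ab X d l a b = order_complex (cau_le d) (Cau X d l a b)"

definition \<Delta>'Cau_ab :: "'a set \<Rightarrow> ('a \<Rightarrow> 'a \<Rightarrow> real) \<Rightarrow> real \<Rightarrow> 'a \<Rightarrow> 'a \<Rightarrow> ('a \<times> real) set set" where
  "\<Delta>'Cau_ab X d l a b =
     {\<sigma> \<in> \<Delta>Cau_ab X d l a b.
        \<exists>ps. set ps = \<sigma> \<and> sorted_wrt (\<lambda>p q. cau_le d p q \<and> p \<noteq> q) ps \<and>
             path_length d (map fst ps) < l}"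

definition \<Delta>Cau :: "'a set \<Rightarrow> ('a \<Rightarrow> 'a \<Rightarrow> real) \<Rightarrow> real \<Rightarrow> (('a \<times> 'a) \<times> 'a \<times> real) set set" where
  "\<Delta>Cau X d l = coprod_complex (X \<times> X) (\<lambda>(a, b). \<Delta>Cau_ab X d l a b)"

definition \<Delta>'Cau :: "'a set \<Rightarrow> ('a \<Rightarrow> 'a \<Rightarrow> real) \<Rightarrow> real \<Rightarrow> (('a \<times> 'a) \<times> 'a \<times> real) set set" where
  "\<Delta>'Cau X d l = coprod_complex (X \<times> X) (\<lambda>(a, b). \<Delta>'Cau_ab X d l a b)"

definition magnitude_homotopy_type ::
  "'a set \<Rightarrow> ('a \<Rightarrow> 'a \<Rightarrow> real) \<Rightarrow> real \<Rightarrow> (('a \<times> 'a) \<times> 'a \<times> real \<Rightarrow> real) option topology" where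
  "magnitude_homotopy_type X d l =
     collapse_topology (complex_realization (\<Delta>Cau X d l)) (complex_carrier (\<Delta>'Cau X d l))"

section \<open>The Hepworth--Willerton simplicial set\<close>

text \<open>A tuple \<open>(x\<^sub>0, \<dots>, x\<^sub>n)\<close> is a list of length \<open>n + 1\<close>; \<^const>\<open>None\<close> is the base point.\<close>

definition hw_simplices ::
  "'a set \<Rightarrow> ('a \<Rightarrow> 'a \<Rightarrow> real) \<Rightarrow> real \<Rightarrow> nat \<Rightarrow> 'a list option set" where
  "hw_simplices X d l n =
     insert None (Some ` {xs. length xs = Suc n \<and> set xs \<subseteq> X \<and> path_length d xs = l})"

definition delete_nth :: "nat \<Rightarrow> 'a list \<Rightarrow> 'a list" where
  "delete_nth i xs = take i xs @ drop (Suc i) xs"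

definition repeat_nth :: "nat \<Rightarrow> 'a list \<Rightarrow> 'a list" where
  "repeat_nth i xs = take (Suc i) xs @ drop i xs"

definition hw_face :: "('a \<Rightarrow> 'a \<Rightarrow> real) \<Rightarrow> real \<Rightarrow> nat \<Rightarrow> 'a list option \<Rightarrow> 'a list option" where
  "hw_face d l i s =
     (case s of
        None \<Rightarrow> None
      | Some xs \<Rightarrow> if path_length d (delete_nth i xs) = l then Some (delete_nth i xs) else None)"

definition hw_simplicial_set ::
  "'a set \<Rightarrow> ('a \<Rightarrow> 'a \<Rightarrow> real) \<Rightarrow> real \<Rightarrow> 'a list option simplicial_set" where
  "hw_simplicial_set X d l =
     \<lparr>simplices = hw_simplices X d l,
      face = (\<lambda>n. hw_face d l),
      degen = (\<lambda>n i. map_option (repeat_nth i))\<rparr>"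

end

theory Submission
  imports Defs
begin

text \<open>
  Let \<open>P\<close> be the space of formal points \<open>(n, s, t)\<close> of the Hepworth--Willerton simplicial set
  before gluing. The proof exhibits one map \<open>compare_point\<close> from \<open>P\<close> to the Tajima--Yoshinaga
  space that is a quotient map and whose fibres are exactly the classes of the gluing relation.
  Since the projection of \<open>P\<close> onto the geometric realization is a quotient map with the same
  fibres, the two spaces are homeomorphic.

  The map comes from a rigidity of the causal order. A chain
  \<open>(x\<^sub>0, t\<^sub>0) < \<dots> < (x\<^sub>n, t\<^sub>n)\<close> between \<open>a\<close> and \<open>b\<close> has path length at most
  \<open>t\<^sub>n - t\<^sub>0 \<le> l\<close>. If the length is \<open>l\<close>, every inequality is an equality: \<open>x\<^sub>0 = a\<close>, \<open>x\<^sub>n = b\<close>, and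
  \<open>t\<^sub>i\<close> is the length of the path from \<open>x\<^sub>0\<close> up to \<open>x\<^sub>i\<close> (lemma \<open>clocked_map_fst\<close>). So the simplices that
  survive the collapse are the tuples of total length \<open>l\<close> without immediate repetitions, each
  point carrying the time at which a traveller of unit speed arrives. Accordingly
  \<open>compare_point\<close> sends \<open>(n, (x\<^sub>0, \<dots>, x\<^sub>n), t)\<close> to the point with barycentric weights \<open>t\<close> on the
  clocked vertices, and everything over the base point to the collapsed point.

  Three facts carry the argument. The map respects the gluing: by rigidity a face of length \<open>l\<close>
  has the same arrival times, and a face that is shorter lies in the collapsed subcomplex
  (\<open>compare_point_face\<close>, \<open>compare_point_degen\<close>). It separates gluing classes: each class contains a
  point that is either over the base point in dimension zero or interior to a nondegenerate
  simplex, and such a point can be read off from its image (\<open>glue_normal_point_exists\<close>,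
  \<open>compare_point_inj_normal\<close>). It is a quotient map: every closed simplex of causal chains lifts
  continuously through it (\<open>closed_simplex_lift\<close>), and these simplices determine the topology of
  the target.
\<close>

section \<open>Quotient maps onto a collapsed complex\<close>

lemma homeomorphic_space_if_quotient_maps_same_fibres:
  assumes f: "quotient_map P Y f" and g: "quotient_map P Z g"
    and fibres: "\<And>x y. x \<in> topspace P \<Longrightarrow> y \<in> topspace P \<Longrightarrow> f x = f y \<longleftrightarrow> g x = g y"
  shows "Y homeomorphic_space Z"
proof -
  obtain k where k: "continuous_map Y Z k" "\<And>x. x \<in> topspace P \<Longrightarrow> k (f x) = g x"
    using quotient_map_lift_exists[OF f quotient_imp_continuous_map[OF g]] fibres by metis
  have "quotient_map P Z (k \<circ> f)"
    using k(2) by (auto intro: quotient_map_eq[OF g])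
  then have "quotient_map Y Z k"
    using quotient_map_from_composition[OF quotient_imp_continuous_map[OF f] k(1)] by blast
  moreover have "inj_on k (topspace Y)"
  proof (rule inj_onI)
    fix y y' assume "y \<in> topspace Y" "y' \<in> topspace Y" "k y = k y'"
    then obtain x x' where "x \<in> topspace P" "y = f x" "x' \<in> topspace P" "y' = f x'"
      using f unfolding quotient_map_def by blast
    then show "y = y'"
      using \<open>k y = k y'\<close> k(2) fibres by auto
  qed
  ultimately show ?thesis
    by (auto intro: homeomorphic_map_imp_homeomorphic_space simp: homeomorphic_map_def)
qed

definition collapse :: "'a set \<Rightarrow> 'a \<Rightarrow> 'a option" where
  "collapse A x = (if x \<in> A then None else Some x)"

lemma openin_collapse_topology:
  "openin (collapse_topology T A) U \<longleftrightarrow>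
     U \<subseteq> insert None (Some ` (topspace T - A)) \<and> openin T {x \<in> topspace T. collapse A x \<in> U}"
  unfolding collapse_topology_def openin_coinduced_topology collapse_def ..

lemma topspace_collapse_topology:
  "topspace (collapse_topology T A) = insert None (Some ` (topspace T - A))"
  unfolding collapse_topology_def by (rule topspace_coinduced_topology) auto

lemma continuous_map_collapse: "continuous_map T (collapse_topology T A) (collapse A)"
  unfolding continuous_map_def topspace_collapse_topology openin_collapse_topology
  by (auto simp: collapse_def)

lemma continuous_map_closed_simplex_inclusion:
  assumes "\<sigma> \<in> K"
  shows "continuous_map (subtopology (powertop_real UNIV) (closed_simplex \<sigma>))
           (complex_realization K) id"
proof -
  have "{x \<in> closed_simplex \<sigma>. x \<in> U} = U \<inter> closed_simplex \<sigma>" for U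
    by blast
  then show ?thesis
    using assms unfolding continuous_map_def
    by (auto simp: topspace_complex_realization openin_complex_realization complex_carrier_def)
qed

text \<open>The weak topology reduces openness in the target to openness in each closed simplex, where the
  lift \<open>e\<close> turns it into openness in \<open>P\<close>. The base point needs its own hypothesis because for empty
  \<open>A\<close> no simplex reaches it.\<close>

lemma quotient_map_onto_collapsed_complex:
  assumes h: "continuous_map P (collapse_topology (complex_realization K) A) h"
    and base: "None \<in> h ` topspace P"
    and lift: "\<And>\<sigma>. \<sigma> \<in> K \<Longrightarrow>
      \<exists>e. continuous_map (subtopology (powertop_real UNIV) (closed_simplex \<sigma>)) P e \<and>
          (\<forall>f\<in>closed_simplex \<sigma>. h (e f) = collapse A f)"
  shows "quotient_map P (collapse_topology (complex_realization K) A) h"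
  unfolding quotient_map_def
proof (intro conjI allI impI)
  let ?C = "collapse_topology (complex_realization K) A"
  show surj: "h ` topspace P = topspace ?C"
  proof (rule antisym)
    show "h ` topspace P \<subseteq> topspace ?C"
      using h by (auto simp: continuous_map_def)
    show "topspace ?C \<subseteq> h ` topspace P"
    proof
      fix z assume z: "z \<in> topspace ?C"
      show "z \<in> h ` topspace P"
      proof (cases z)
        case None
        then show ?thesis using base by simp
      next
        case (Some f)
        with z obtain \<sigma> where "\<sigma> \<in> K" "f \<in> closed_simplex \<sigma>" "f \<notin> A"
          by (auto simp: topspace_collapse_topology topspace_complex_realization complex_carrier_def)
        then obtain e where e: "continuous_map (subtopology (powertop_real UNIV) (closed_simplex \<sigma>)) P e"
            "h (e f) = collapse A f"
          using lift by blast
        have "e f \<in> topspace P"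
          using e(1) \<open>f \<in> closed_simplex \<sigma>\<close> by (auto simp: continuous_map_def)
        then show ?thesis
          using e(2) Some \<open>f \<notin> A\<close> by (force simp: collapse_def)
      qed
    qed
  qed
  fix U assume U: "U \<subseteq> topspace ?C"
  show "openin P {x \<in> topspace P. h x \<in> U} = openin ?C U"
  proof
    assume "openin ?C U"
    then show "openin P {x \<in> topspace P. h x \<in> U}"
      using h by (simp add: continuous_map_def)
  next
    assume V: "openin P {x \<in> topspace P. h x \<in> U}"
    have "openin (subtopology (powertop_real UNIV) (closed_simplex \<sigma>))
            ({f \<in> complex_carrier K. collapse A f \<in> U} \<inter> closed_simplex \<sigma>)" if "\<sigma> \<in> K" for \<sigma>
    proof -
      obtain e where e: "continuous_map (subtopology (powertop_real UNIV) (closed_simplex \<sigma>)) P e"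
          "\<And>f. f \<in> closed_simplex \<sigma> \<Longrightarrow> h (e f) = collapse A f"
        using lift[OF \<open>\<sigma> \<in> K\<close>] by blast
      have "openin (subtopology (powertop_real UNIV) (closed_simplex \<sigma>))
              {f \<in> closed_simplex \<sigma>. e f \<in> {x \<in> topspace P. h x \<in> U}}"
        using openin_continuous_map_preimage[OF e(1) V] by simp
      also have "{f \<in> closed_simplex \<sigma>. e f \<in> {x \<in> topspace P. h x \<in> U}} =
          {f \<in> complex_carrier K. collapse A f \<in> U} \<inter> closed_simplex \<sigma>"
        using e that by (auto simp: continuous_map_def complex_carrier_def)
      finally show ?thesis .
    qed
    then show "openin ?C U"
      using U by (auto simp: openin_collapse_topology openin_complex_realization
          topspace_complex_realization topspace_collapse_topology)
  qed
qed

section \<open>The space of formal simplices of a simplicial set\<close>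

lemma openin_prod_discrete_topology:
  "openin (prod_topology (discrete_topology D) Y) W \<longleftrightarrow>
     W \<subseteq> D \<times> topspace Y \<and> (\<forall>s\<in>D. openin Y {t. (s, t) \<in> W})"
proof (intro iffI conjI ballI)
  assume W: "openin (prod_topology (discrete_topology D) Y) W"
  then show sub: "W \<subseteq> D \<times> topspace Y"
    using openin_subset by fastforce
  fix s assume "s \<in> D"
  then have "continuous_map Y (prod_topology (discrete_topology D) Y) (Pair s)"
    by (simp add: continuous_map_pairedI)
  from openin_continuous_map_preimage[OF this W]
  have "openin Y {t \<in> topspace Y. (s, t) \<in> W}" .
  moreover have "{t \<in> topspace Y. (s, t) \<in> W} = {t. (s, t) \<in> W}"
    using sub by blast
  ultimately show "openin Y {t. (s, t) \<in> W}" by simp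
next
  assume W: "W \<subseteq> D \<times> topspace Y \<and> (\<forall>s\<in>D. openin Y {t. (s, t) \<in> W})"
  then have "W = (\<Union>s\<in>D. {s} \<times> {t. (s, t) \<in> W})"
    by auto
  moreover have "openin (prod_topology (discrete_topology D) Y) (\<Union>s\<in>D. {s} \<times> {t. (s, t) \<in> W})"
    using W by (intro openin_Union) (auto simp: openin_prod_Times_iff)
  ultimately show "openin (prod_topology (discrete_topology D) Y) W"
    by simp
qed

lemma topspace_sset_prerealization:
  "topspace (sset_prerealization S) = {(n, s, t). s \<in> simplices S n \<and> t \<in> standard_simplex n}"
  unfolding sset_prerealization_def by (auto simp: o_def)

text \<open>As the simplices carry the discrete topology, a set is open as soon as its slice over each
  single simplex is.\<close>

lemma openin_sset_prerealization:
  "openin (sset_prerealization S) V \<longleftrightarrow>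
     V \<subseteq> topspace (sset_prerealization S) \<and>
     (\<forall>n. \<forall>s\<in>simplices S n. openin (subtopology (powertop_real UNIV) (standard_simplex n))
        {t. (n, s, t) \<in> V})"
  unfolding topspace_sset_prerealization
  unfolding sset_prerealization_def openin_sum_topology openin_prod_discrete_topology
  by (auto simp: o_def)

lemma continuous_map_from_sset_prerealization:
  assumes "\<And>n s. s \<in> simplices S n \<Longrightarrow>
    continuous_map (subtopology (powertop_real UNIV) (standard_simplex n)) Y (\<lambda>t. h (n, s, t))"
  shows "continuous_map (sset_prerealization S) Y h"
  unfolding continuous_map_def
proof (intro conjI allI impI)
  show "h \<in> topspace (sset_prerealization S) \<rightarrow> topspace Y"
    using assms by (fastforce simp: continuous_map_def topspace_sset_prerealization)
  fix U assume U: "openin Y U"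
  show "openin (sset_prerealization S) {p \<in> topspace (sset_prerealization S). h p \<in> U}"
    unfolding openin_sset_prerealization
  proof (intro conjI allI ballI)
    fix n s assume s: "s \<in> simplices S n"
    have "{t. (n, s, t) \<in> {p \<in> topspace (sset_prerealization S). h p \<in> U}} =
        {t \<in> standard_simplex n. h (n, s, t) \<in> U}"
      using s by (auto simp: topspace_sset_prerealization)
    then show "openin (subtopology (powertop_real UNIV) (standard_simplex n))
        {t. (n, s, t) \<in> {p \<in> topspace (sset_prerealization S). h p \<in> U}}"
      using openin_continuous_map_preimage[OF assms[OF s] U] by simp
  qed auto
qed

lemma continuous_map_into_sset_prerealization:
  assumes s: "s \<in> simplices S n"
    and e: "continuous_map Z (subtopology (powertop_real UNIV) (standard_simplex n)) e"
  shows "continuous_map Z (sset_prerealization S) (\<lambda>z. (n, s, e z))"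
  unfolding continuous_map_def
proof (intro conjI allI impI)
  show "(\<lambda>z. (n, s, e z)) \<in> topspace Z \<rightarrow> topspace (sset_prerealization S)"
    using assms by (auto simp: continuous_map_def topspace_sset_prerealization)
  fix V assume "openin (sset_prerealization S) V"
  then have "openin (subtopology (powertop_real UNIV) (standard_simplex n)) {t. (n, s, t) \<in> V}"
    using s by (simp add: openin_sset_prerealization)
  from openin_continuous_map_preimage[OF e this]
  show "openin Z {z \<in> topspace Z. (n, s, e z) \<in> V}"
    by simp
qed

lemma quotient_map_sset_realization:
  "quotient_map (sset_prerealization S) (sset_realization S) (\<lambda>p. {p'. equivclp (glue S) p p'})"
  unfolding sset_realization_def Let_def by (rule quotient_map_coinduced_topology)

lemma glue_class_eq_iff:
  "{p'. equivclp (glue S) p p'} = {p'. equivclp (glue S) q p'} \<longleftrightarrow> equivclp (glue S) p q"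
  by (metis (no_types, lifting) equivclp_refl equivclp_sym equivclp_trans mem_Collect_eq Collect_cong)

section \<open>Barycentric coordinates on a list of vertices\<close>

text \<open>The list may repeat a vertex; the weights of its occurrences add up. Degenerate tuples give
  rise to such lists, and merging weights is what a codegeneracy does.\<close>

definition barycentric :: "'v list \<Rightarrow> (nat \<Rightarrow> real) \<Rightarrow> 'v \<Rightarrow> real" where
  "barycentric vs t = (\<lambda>v. \<Sum>j<length vs. if vs ! j = v then t j else 0)"

lemma barycentric_Cons:
  "barycentric (x # ws) t v = (if x = v then t 0 else 0) + barycentric ws (\<lambda>j. t (Suc j)) v"
  unfolding barycentric_def by (simp add: sum.lessThan_Suc_shift del: sum.lessThan_Suc)

lemma barycentric_append:
  "barycentric (us @ ws) t v = barycentric us t v + barycentric ws (\<lambda>j. t (length us + j)) v"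
proof (induction us arbitrary: t)
  case Nil
  show ?case by (simp add: barycentric_def)
next
  case (Cons u us)
  show ?case by (simp add: barycentric_Cons Cons.IH)
qed

lemma barycentric_cong:
  "(\<And>j. j < length vs \<Longrightarrow> t j = u j) \<Longrightarrow> barycentric vs t = barycentric vs u"
  unfolding barycentric_def by (auto intro!: sum.cong)

lemma barycentric_split_at:
  assumes "i < length vs"
  shows "barycentric vs t v = barycentric (take i vs) t v +
           ((if vs ! i = v then t i else 0) + barycentric (drop (Suc i) vs) (\<lambda>j. t (Suc (i + j))) v)"
proof -
  have "barycentric (take i vs @ vs ! i # drop (Suc i) vs) t v = barycentric (take i vs) t v +
      ((if vs ! i = v then t i else 0) + barycentric (drop (Suc i) vs) (\<lambda>j. t (Suc (i + j))) v)"
    unfolding barycentric_append barycentric_Cons using assms by simp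
  then show ?thesis
    by (simp only: id_take_nth_drop[OF assms, symmetric])
qed

text \<open>A vertex of weight zero can be dropped, so on vertex lists the coface maps become deletions.\<close>

lemma barycentric_face:
  assumes "i < length vs"
  shows "barycentric vs (simplical_face i t) = barycentric (delete_nth i vs) t"
proof
  fix v
  have "barycentric (take i vs) (simplical_face i t) = barycentric (take i vs) t"
    by (rule barycentric_cong) (simp add: simplical_face_def)
  moreover have "barycentric (drop (Suc i) vs) (\<lambda>j. simplical_face i t (Suc (i + j))) =
      barycentric (drop (Suc i) vs) (\<lambda>j. t (i + j))"
    by (rule barycentric_cong) (simp add: simplical_face_def)
  moreover have "simplical_face i t i = 0"
    by (simp add: simplical_face_def)
  ultimately show "barycentric vs (simplical_face i t) v = barycentric (delete_nth i vs) t v"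
    using assms by (simp add: barycentric_split_at[OF assms] delete_nth_def barycentric_append)
qed

lemma barycentric_degen:
  assumes "i < length vs"
  shows "barycentric (repeat_nth i vs) t = barycentric vs (simplicial_degen i t)"
proof
  fix v
  have repeat: "repeat_nth i vs = take i vs @ vs ! i # vs ! i # drop (Suc i) vs"
    using assms by (simp add: repeat_nth_def take_Suc_conv_app_nth Cons_nth_drop_Suc)
  have "barycentric (take i vs) (simplicial_degen i t) = barycentric (take i vs) t"
    by (rule barycentric_cong) (simp add: simplicial_degen_def)
  moreover have "barycentric (drop (Suc i) vs) (\<lambda>j. simplicial_degen i t (Suc (i + j))) =
      barycentric (drop (Suc i) vs) (\<lambda>j. t (Suc (Suc (i + j))))"
    by (rule barycentric_cong) (simp add: simplicial_degen_def)
  moreover have "simplicial_degen i t i = t i + t (Suc i)"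
    by (simp add: simplicial_degen_def)
  ultimately show "barycentric (repeat_nth i vs) t v = barycentric vs (simplicial_degen i t) v"
    using assms unfolding repeat
    by (simp add: barycentric_split_at[OF assms] barycentric_append barycentric_Cons)
qed

lemma barycentric_replicate: "barycentric (replicate n v) t v = (\<Sum>j<n. t j)"
  unfolding barycentric_def by simp

lemma barycentric_nth:
  assumes "distinct vs" "j < length vs"
  shows "barycentric vs t (vs ! j) = t j"
proof -
  have "barycentric vs t (vs ! j) = (\<Sum>k<length vs. if k = j then t k else 0)"
    unfolding barycentric_def using assms by (intro sum.cong) (auto simp: nth_eq_iff_index_eq)
  then show ?thesis using assms by simp
qed

lemma barycentric_outside: "v \<notin> set vs \<Longrightarrow> barycentric vs t v = 0"
  unfolding barycentric_def by (auto intro!: sum.neutral)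

lemma standard_simplexI:
  assumes "\<And>i. 0 \<le> t i" "\<And>i. n < i \<Longrightarrow> t i = 0" "sum t {..n} = 1"
  shows "t \<in> standard_simplex n"
proof -
  have "t i \<le> 1" for i
  proof (cases "i \<le> n")
    case True
    then have "t i \<le> sum t {..n}"
      using assms(1) by (intro member_le_sum) auto
    then show ?thesis using assms(3) by simp
  qed (use assms(2) in auto)
  then show ?thesis
    using assms unfolding standard_simplex_def by auto
qed

lemma sum_standard_simplex: "t \<in> standard_simplex n \<Longrightarrow> (\<Sum>j<Suc n. t j) = 1"
  by (simp add: standard_simplex_def lessThan_Suc_atMost del: sum.lessThan_Suc)

lemma barycentric_in_closed_simplex:
  assumes "length vs = Suc n" "t \<in> standard_simplex n"
  shows "barycentric vs t \<in> closed_simplex (set vs)"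
proof -
  have "sum (barycentric vs t) (set vs) =
      (\<Sum>j<length vs. \<Sum>v\<in>set vs. if vs ! j = v then t j else 0)"
    unfolding barycentric_def by (rule sum.swap)
  also have "\<dots> = (\<Sum>j<length vs. t j)"
    by (intro sum.cong) auto
  also have "\<dots> = 1"
    using assms sum_standard_simplex by simp
  finally show ?thesis
    using assms(2) barycentric_outside[of _ vs t]
    by (auto simp: closed_simplex_def barycentric_def standard_simplex_def intro!: sum_nonneg)
qed

lemma continuous_map_barycentric:
  assumes "length vs = Suc n" "set vs \<in> K"
  shows "continuous_map (subtopology (powertop_real UNIV) (standard_simplex n))
           (complex_realization K) (barycentric vs)"
proof -
  have "continuous_map (subtopology (powertop_real UNIV) (standard_simplex n)) euclideanreal
      (\<lambda>t. if vs ! j = v then t j else 0)" for j v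
    by (cases "vs ! j = v")
      (auto intro: continuous_map_from_subtopology continuous_map_product_projection)
  then have "continuous_map (subtopology (powertop_real UNIV) (standard_simplex n))
      (powertop_real UNIV) (barycentric vs)"
    unfolding continuous_map_componentwise_UNIV barycentric_def
    by (intro allI continuous_map_sum) auto
  then have "continuous_map (subtopology (powertop_real UNIV) (standard_simplex n))
      (subtopology (powertop_real UNIV) (closed_simplex (set vs))) (barycentric vs)"
    using barycentric_in_closed_simplex[OF assms(1)]
    by (auto simp: continuous_map_in_subtopology)
  from continuous_map_compose[OF this continuous_map_closed_simplex_inclusion[OF assms(2)]]
  show ?thesis by simp
qed

lemma simplicial_degen_in_standard_simplex:
  assumes "i \<le> n" "t \<in> standard_simplex (Suc n)"
  shows "simplicial_degen i t \<in> standard_simplex n"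
proof (rule standard_simplexI)
  (* On a list with a single vertex the barycentric weight is the total sum of coordinates. *)
  have "repeat_nth i (replicate (Suc n) ()) = replicate (Suc (Suc n)) ()"
    using assms(1) by (auto simp: repeat_nth_def list_eq_iff_nth_eq)
  then have "(\<Sum>j<Suc n. simplicial_degen i t j) = (\<Sum>j<Suc (Suc n). t j)"
    using barycentric_degen[of i "replicate (Suc n) ()" t] assms(1)
    by (metis barycentric_replicate length_replicate less_Suc_eq_le)
  then show "sum (simplicial_degen i t) {..n} = 1"
    using sum_standard_simplex[OF assms(2)] by (simp add: lessThan_Suc_atMost)
  have t: "\<And>j. 0 \<le> t j" "\<And>j. Suc n < j \<Longrightarrow> t j = 0"
    using assms(2) by (simp_all add: standard_simplex_def)
  show "0 \<le> simplicial_degen i t j" for j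
    using t(1) by (simp add: simplicial_degen_def)
  show "simplicial_degen i t j = 0" if "n < j" for j
    using t(2) assms(1) that by (simp add: simplicial_degen_def)
qed

text \<open>A point on the boundary is the image of a coface map, which lets the face gluing lower its
  dimension.\<close>

lemma standard_simplex_zero_is_face:
  assumes t: "t \<in> standard_simplex (Suc n)" and i: "i \<le> Suc n" and "t i = 0"
  obtains u where "u \<in> standard_simplex n" "t = simplical_face i u"
proof -
  define u where "u = (\<lambda>j. if j < i then t j else t (Suc j))"
  have "simplical_face i u j = t j" for j
    using \<open>t i = 0\<close> by (cases j) (auto simp: simplical_face_def u_def)
  then have face: "simplical_face i u = t"
    by blast
  have "u \<in> standard_simplex n"
  proof (rule standard_simplexI)
    have "delete_nth i (replicate (Suc (Suc n)) ()) = replicate (Suc n) ()"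
      by (rule nth_equalityI) (use i in \<open>simp_all add: delete_nth_def\<close>)
    then have "barycentric (replicate (Suc (Suc n)) ()) t = barycentric (replicate (Suc n) ()) u"
      using barycentric_face[of i "replicate (Suc (Suc n)) ()" u] i
      unfolding face by (simp del: replicate_Suc)
    then have "(\<Sum>j<Suc (Suc n). t j) = (\<Sum>j<Suc n. u j)"
      unfolding barycentric_replicate[of _ "()", symmetric] by simp
    then show "sum u {..n} = 1"
      using sum_standard_simplex[OF t] by (simp only: lessThan_Suc_atMost)
    have nonneg: "\<And>j. 0 \<le> t j" and zero: "\<And>j. Suc n < j \<Longrightarrow> t j = 0"
      using t by (simp_all add: standard_simplex_def)
    show "0 \<le> u j" for j
      using nonneg by (simp add: u_def)
    show "u j = 0" if "n < j" for j
      using zero i that by (simp add: u_def)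
  qed
  then show thesis
    using that face by metis
qed

section \<open>Path length and elapsed time\<close>

definition elapsed :: "('a \<Rightarrow> 'a \<Rightarrow> real) \<Rightarrow> 'a list \<Rightarrow> nat \<Rightarrow> real" where
  "elapsed d xs k = (\<Sum>i<k. d (xs ! i) (xs ! Suc i))"

text \<open>The tuple together with the times at which a traveller of unit speed reaches its entries.\<close>

definition clocked :: "('a \<Rightarrow> 'a \<Rightarrow> real) \<Rightarrow> 'a list \<Rightarrow> ('a \<times> real) list" where
  "clocked d xs = map (\<lambda>i. (xs ! i, elapsed d xs i)) [0..<length xs]"

lemma elapsed_0 [simp]: "elapsed d xs 0 = 0"
  by (simp add: elapsed_def)

lemma elapsed_Suc [simp]: "elapsed d xs (Suc k) = elapsed d xs k + d (xs ! k) (xs ! Suc k)"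
  by (simp add: elapsed_def)

lemma path_length_eq_elapsed: "path_length d xs = elapsed d xs (length xs - 1)"
  by (simp add: path_length_def elapsed_def)

lemma length_clocked [simp]: "length (clocked d xs) = length xs"
  by (simp add: clocked_def)

lemma nth_clocked [simp]: "i < length xs \<Longrightarrow> clocked d xs ! i = (xs ! i, elapsed d xs i)"
  by (simp add: clocked_def)

lemma map_fst_clocked [simp]: "map fst (clocked d xs) = xs"
  by (rule nth_equalityI) simp_all

lemma path_length_Cons_Cons: "path_length d (x # y # zs) = d x y + path_length d (y # zs)"
  by (simp add: path_length_def sum.lessThan_Suc_shift del: sum.lessThan_Suc)

lemma path_length_singleton [simp]: "path_length d [x] = 0"
  by (simp add: path_length_def)

lemma path_length_split:
  "path_length d (us @ x # vs) = path_length d (us @ [x]) + path_length d (x # vs)"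
proof (induction us)
  case (Cons u us)
  then show ?case by (cases us) (simp_all add: path_length_Cons_Cons)
qed simp

text \<open>Standing still costs nothing. This allows weakly increasing lists to replace the strictly
  increasing ones that list the simplices of a complex.\<close>

lemma path_length_map_remdups_adj:
  "(\<And>p. p \<in> set ps \<Longrightarrow> d (f p) (f p) = 0) \<Longrightarrow>
     path_length d (map f (remdups_adj ps)) = path_length d (map f ps)"
proof (induction ps rule: remdups_adj.induct)
  case (3 x y xs)
  obtain zs where "remdups_adj (y # xs) = y # zs"
    using remdups_adj_Cons' by metis
  then show ?case
    using 3 by (auto simp: path_length_Cons_Cons)
qed simp_all

lemma map_delete_nth: "map f (delete_nth i xs) = delete_nth i (map f xs)"
  by (simp add: delete_nth_def take_map drop_map)

lemma map_repeat_nth: "map f (repeat_nth i xs) = repeat_nth i (map f xs)"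
  by (simp add: repeat_nth_def take_map drop_map)

lemma repeat_nth_eq:
  "i < length xs \<Longrightarrow> repeat_nth i xs = take i xs @ xs ! i # xs ! i # drop (Suc i) xs"
  by (simp add: repeat_nth_def take_Suc_conv_app_nth Cons_nth_drop_Suc)

lemma repeat_delete_nth:
  assumes "Suc i < length xs" "xs ! i = xs ! Suc i"
  shows "repeat_nth i (delete_nth i xs) = xs"
proof -
  have "delete_nth i xs ! i = xs ! i"
    using assms by (simp add: delete_nth_def nth_append)
  then show ?thesis
    using assms Cons_nth_drop_Suc[of "Suc i" xs] id_take_nth_drop[of i xs]
    by (subst repeat_nth_eq) (auto simp: delete_nth_def)
qed

lemma set_delete_nth_subset: "set (delete_nth i xs) \<subseteq> set xs"
  by (auto simp: delete_nth_def dest: in_set_takeD in_set_dropD)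

lemma length_delete_nth: "i < length xs \<Longrightarrow> length (delete_nth i xs) = length xs - 1"
  by (simp add: delete_nth_def)

lemma set_repeat_nth: "i < length xs \<Longrightarrow> set (repeat_nth i xs) = set xs"
  using arg_cong[OF id_take_nth_drop[of i xs], of set] by (simp add: repeat_nth_eq)

lemma sorted_wrt_delete_nth:
  assumes "sorted_wrt P xs"
  shows "sorted_wrt P (delete_nth i xs)"
proof -
  have "sorted_wrt P (take i xs @ drop i xs)"
    using assms by simp
  moreover have "set (drop (Suc i) xs) \<subseteq> set (drop i xs)"
    by (rule set_drop_subset_set_drop) simp
  ultimately show ?thesis
    using sorted_wrt_drop[OF assms, of "Suc i"]
    unfolding delete_nth_def sorted_wrt_append by blast
qed

context Metric_space
begin

lemma self_distance [simp]: "x \<in> M \<Longrightarrow> d x x = 0"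
  by simp

lemma dist_le_elapsed:
  assumes "set xs \<subseteq> M" "i \<le> j" "j < length xs"
  shows "d (xs ! i) (xs ! j) \<le> elapsed d xs j - elapsed d xs i"
  using assms(2,3)
proof (induction j rule: dec_induct)
  case base
  then show ?case using assms by (simp add: subset_iff)
next
  case (step j)
  then have "xs ! i \<in> M" "xs ! j \<in> M" "xs ! Suc j \<in> M"
    using assms(1) by (auto simp: subset_iff)
  then show ?case
    using triangle[of "xs ! i" "xs ! j" "xs ! Suc j"] step by simp
qed

lemma elapsed_mono:
  assumes "i \<le> j"
  shows "elapsed d xs i \<le> elapsed d xs j"
  using assms by (induction j rule: dec_induct) (simp_all add: add_increasing2)

lemma path_length_repeat_nth:
  assumes "set xs \<subseteq> M" "i < length xs"
  shows "path_length d (repeat_nth i xs) = path_length d xs"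
proof -
  let ?us = "take i xs" and ?x = "xs ! i" and ?vs = "drop (Suc i) xs"
  have "path_length d (?us @ ?x # ?x # ?vs) = path_length d (?us @ ?x # ?vs)"
    using path_length_split[of d ?us ?x "?x # ?vs"] path_length_split[of d ?us ?x ?vs] assms
    by (simp add: path_length_Cons_Cons subset_iff)
  then show ?thesis
    by (simp only: repeat_nth_eq[OF assms(2)] id_take_nth_drop[OF assms(2), symmetric])
qed

section \<open>Chains in the causal order\<close>

text \<open>Entries may be repeated: this class of lists, unlike that of strict chains, is stable under
  the deletions and repetitions that faces and degeneracies perform.\<close>

definition cau_list :: "real \<Rightarrow> 'a \<Rightarrow> 'a \<Rightarrow> ('a \<times> real) list \<Rightarrow> bool" where
  "cau_list l a b ps \<longleftrightarrow>
     a \<in> M \<and> b \<in> M \<and> ps \<noteq> [] \<and> set ps \<subseteq> Cau M d l a b \<and> sorted_wrt (cau_le d) ps"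

lemma cau_list_nth:
  assumes "cau_list l a b ps" "i < length ps"
  shows "fst (ps ! i) \<in> M" "0 \<le> snd (ps ! i)" "snd (ps ! i) \<le> l"
    "d a (fst (ps ! i)) \<le> snd (ps ! i)" "d (fst (ps ! i)) b \<le> l - snd (ps ! i)"
proof -
  have "ps ! i \<in> Cau M d l a b"
    using assms by (auto simp: cau_list_def)
  then show "fst (ps ! i) \<in> M" "0 \<le> snd (ps ! i)" "snd (ps ! i) \<le> l"
    "d a (fst (ps ! i)) \<le> snd (ps ! i)" "d (fst (ps ! i)) b \<le> l - snd (ps ! i)"
    by (auto simp: Cau_def)
qed

text \<open>Travelling at speed at most one, the path covers no more than the time that passes between
  two of its events.\<close>

lemma elapsed_le_time:
  assumes "cau_list l a b ps" "i \<le> j" "j < length ps"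
  shows "elapsed d (map fst ps) j - elapsed d (map fst ps) i \<le> snd (ps ! j) - snd (ps ! i)"
  using assms(2,3)
proof (induction j rule: dec_induct)
  case (step j)
  then have "cau_le d (ps ! j) (ps ! Suc j)"
    using assms(1) by (simp add: cau_list_def sorted_wrt_iff_nth_less)
  then show ?case
    using step by (simp add: cau_le_def)
qed simp

lemma path_length_le:
  assumes "cau_list l a b ps"
  shows "path_length d (map fst ps) \<le> l"
proof -
  have "ps \<noteq> []"
    using assms by (simp add: cau_list_def)
  then show ?thesis
    using elapsed_le_time[OF assms, of 0 "length ps - 1"] cau_list_nth(3)[OF assms, of "length ps - 1"]
      cau_list_nth(2)[OF assms, of 0]
    by (simp add: path_length_eq_elapsed)
qed

text \<open>The rigidity behind the whole comparison. If the path length is \<open>l\<close>, the path up to the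
  \<open>i\<close>-th entry is at most \<open>t\<^sub>i\<close> long and the rest at most \<open>l - t\<^sub>i\<close>; both bounds are then attained.
  Nothing is left for the distances from \<open>a\<close> and to \<open>b\<close>, so these endpoints belong to the path.\<close>

lemma clocked_map_fst:
  assumes ps: "cau_list l a b ps" and l: "path_length d (map fst ps) = l"
  shows "clocked d (map fst ps) = ps" "hd (map fst ps) = a" "last (map fst ps) = b"
proof -
  have ne: "ps \<noteq> []" and ab: "a \<in> M" "b \<in> M"
    using ps by (simp_all add: cau_list_def)
  let ?n = "length ps - 1"
  have n: "?n < length ps" "0 < length ps"
    using ne by simp_all
  have time: "elapsed d (map fst ps) i = snd (ps ! i)" if "i < length ps" for i
  proof -
    have "i \<le> ?n" using that by simp
    then show ?thesis
      using elapsed_le_time[OF ps, of 0 i] elapsed_le_time[OF ps, of i ?n] l that n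
        cau_list_nth(2)[OF ps n(2)] cau_list_nth(3)[OF ps n(1)]
      by (simp add: path_length_eq_elapsed)
  qed
  show "clocked d (map fst ps) = ps"
    by (rule nth_equalityI) (simp_all add: time prod_eq_iff)
  have "snd (ps ! 0) = 0" "snd (ps ! ?n) = l"
    using time[OF n(2)] time[OF n(1)] l by (simp_all add: path_length_eq_elapsed)
  then have "d a (fst (ps ! 0)) = 0" "d (fst (ps ! ?n)) b = 0"
    using cau_list_nth(4)[OF ps n(2)] cau_list_nth(5)[OF ps n(1)]
      nonneg[of a "fst (ps ! 0)"] nonneg[of "fst (ps ! ?n)" b] by linarith+
  then show "hd (map fst ps) = a" "last (map fst ps) = b"
    using ab cau_list_nth(1)[OF ps n(2)] cau_list_nth(1)[OF ps n(1)] ne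
    by (simp_all add: hd_map last_map hd_conv_nth last_conv_nth)
qed

lemma cau_list_clocked:
  assumes "xs \<noteq> []" "set xs \<subseteq> M" "path_length d xs = l"
  shows "cau_list l (hd xs) (last xs) (clocked d xs)"
proof -
  have "clocked d xs ! i \<in> Cau M d l (hd xs) (last xs)" if "i < length xs" for i
  proof -
    have "d (xs ! 0) (xs ! i) \<le> elapsed d xs i"
      using dist_le_elapsed[of xs 0 i] assms(2) that by simp
    moreover have "d (xs ! i) (xs ! (length xs - 1)) \<le> l - elapsed d xs i"
      using dist_le_elapsed[of xs i "length xs - 1"] assms that by (simp add: path_length_eq_elapsed)
    moreover have "0 \<le> elapsed d xs i" "elapsed d xs i \<le> l"
      using elapsed_mono[of 0 i xs] elapsed_mono[of i "length xs - 1" xs] assms that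
      by (simp_all add: path_length_eq_elapsed)
    ultimately show ?thesis
      using that assms by (auto simp: Cau_def hd_conv_nth last_conv_nth)
  qed
  then have "set (clocked d xs) \<subseteq> Cau M d l (hd xs) (last xs)"
    by (metis in_set_conv_nth length_clocked subsetI)
  moreover have "sorted_wrt (cau_le d) (clocked d xs)"
    using dist_le_elapsed[OF assms(2)] by (simp add: sorted_wrt_iff_nth_less cau_le_def)
  ultimately show ?thesis
    using assms by (auto simp: cau_list_def clocked_def subset_iff)
qed

lemma cau_list_delete_nth:
  assumes "cau_list l a b ps" "delete_nth i ps \<noteq> []"
  shows "cau_list l a b (delete_nth i ps)"
  using assms set_delete_nth_subset[of i ps] sorted_wrt_delete_nth
  unfolding cau_list_def by blast

lemma cau_list_repeat_nth:
  assumes "cau_list l a b ps" "i < length ps"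
  shows "cau_list l a b (repeat_nth i ps)"
proof -
  have "cau_le d (ps ! i) (ps ! i)"
    using cau_list_nth(1)[OF assms] by (simp add: cau_le_def)
  moreover have "sorted_wrt (cau_le d) (take i ps @ ps ! i # drop (Suc i) ps)"
    using assms unfolding id_take_nth_drop[OF assms(2), symmetric] cau_list_def by simp
  ultimately have "sorted_wrt (cau_le d) (repeat_nth i ps)"
    by (auto simp: repeat_nth_eq[OF assms(2)] sorted_wrt_append)
  moreover have "repeat_nth i ps \<noteq> []"
    using assms(2) by (simp add: repeat_nth_eq)
  ultimately show ?thesis
    using assms set_repeat_nth[OF assms(2)] by (simp add: cau_list_def)
qed

lemma set_cau_list_in_\<Delta>Cau_ab:
  assumes "cau_list l a b ps"
  shows "set ps \<in> \<Delta>Cau_ab M d l a b"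
proof -
  have "cau_le d p p" if "p \<in> set ps" for p
    using that assms by (auto simp: cau_list_def Cau_def cau_le_def)
  moreover have "cau_le d (ps ! i) (ps ! j)" if "i < j" "j < length ps" for i j
    using that assms by (simp add: cau_list_def sorted_wrt_iff_nth_less)
  ultimately have "Complete_Partial_Order.chain (cau_le d) (set ps)"
    by (intro chainI) (metis in_set_conv_nth linorder_neqE_nat)
  then show ?thesis
    using assms by (simp add: \<Delta>Cau_ab_def order_complex_def cau_list_def)
qed

text \<open>Equal entries of a weakly sorted list are adjacent, so merging neighbours lists the same set as a
  strict chain of the same length.\<close>

lemma set_cau_list_in_\<Delta>'Cau_ab:
  assumes ps: "cau_list l a b ps" and short: "path_length d (map fst ps) < l"
  shows "set ps \<in> \<Delta>'Cau_ab M d l a b"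
proof -
  let ?lt = "\<lambda>p q. cau_le d p q \<and> p \<noteq> q"
  let ?qs = "remdups_adj ps"
  have inM: "fst p \<in> M" if "p \<in> set ps" for p
    using that ps by (auto simp: cau_list_def Cau_def)
  have "successively (cau_le d) ps"
    using ps by (simp add: cau_list_def successively_if_sorted_wrt)
  then have "successively (cau_le d) ?qs"
    by (rule successively_remdups_adjI)
  moreover have "successively (\<noteq>) ?qs"
    using distinct_adj_remdups_adj[of ps] by (simp add: distinct_adj_def)
  ultimately have successive: "successively ?lt ?qs"
    by (simp add: successively_conv_nth)
  have trans: "?lt p r" if "p \<in> set ps" "q \<in> set ps" "r \<in> set ps" "?lt p q" "?lt q r" for p q r
  proof -
    have "d (fst p) (fst r) \<le> d (fst p) (fst q) + d (fst q) (fst r)"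
      using that inM by (intro triangle) auto
    then have "cau_le d p r"
      using that by (simp add: cau_le_def)
    moreover have "p \<noteq> r"
    proof
      assume "p = r"
      then have "d (fst p) (fst q) \<le> snd q - snd p" "d (fst q) (fst p) \<le> snd p - snd q"
        using that by (simp_all add: cau_le_def)
      then have "d (fst p) (fst q) = 0" "snd p = snd q"
        using nonneg[of "fst p" "fst q"] nonneg[of "fst q" "fst p"] by linarith+
      then show False
        using that inM by (auto simp: prod_eq_iff)
    qed
    ultimately show ?thesis by simp
  qed
  have sorted: "sorted_wrt ?lt ?qs"
  proof (rule iffD1[OF successively_iff_sorted_wrt_strong successive])
    fix p q r assume "p \<in> set ?qs" "q \<in> set ?qs" "r \<in> set ?qs" "?lt p q" "?lt q r"
    then show "?lt p r"
      unfolding remdups_adj_set by (rule trans)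
  qed
  have "path_length d (map fst ?qs) = path_length d (map fst ps)"
    using inM by (intro path_length_map_remdups_adj) simp
  then show ?thesis
    using set_cau_list_in_\<Delta>Cau_ab[OF ps] sorted short
    unfolding \<Delta>'Cau_ab_def by (intro CollectI conjI exI[of _ ?qs]) simp_all
qed

lemma \<Delta>Cau_ab_cases:
  assumes "\<sigma> \<in> \<Delta>Cau_ab M d l a b" "a \<in> M" "b \<in> M"
  obtains ps where "cau_list l a b ps" "distinct ps" "set ps = \<sigma>"
proof -
  have \<sigma>: "\<sigma> \<subseteq> Cau M d l a b" "finite \<sigma>" "\<sigma> \<noteq> {}" "Complete_Partial_Order.chain (cau_le d) \<sigma>"
    using assms by (simp_all add: \<Delta>Cau_ab_def order_complex_def)
  obtain qs where qs: "set qs = \<sigma>" "distinct qs"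
    using finite_distinct_list[OF \<sigma>(2)] by blast
  (* Any two points of a chain are comparable, hence ordered as their times are. *)
  let ?ps = "sort_key snd qs"
  have "cau_le d (?ps ! i) (?ps ! j)" if "i < j" "j < length ?ps" for i j
  proof -
    have mem: "?ps ! i \<in> \<sigma>" "?ps ! j \<in> \<sigma>"
      using that qs(1) by (metis nth_mem order.strict_trans set_sort)+
    have le: "snd (?ps ! i) \<le> snd (?ps ! j)"
      using sorted_sort_key[of snd qs] that by (simp add: sorted_iff_nth_mono_less)
    show ?thesis
      using chainD[OF \<sigma>(4) mem] le nonneg[of "fst (?ps ! j)" "fst (?ps ! i)"]
      by (auto simp: cau_le_def commute)
  qed
  moreover have "?ps \<noteq> []"
    using \<sigma>(3) qs(1) by (metis set_empty set_sort)
  ultimately have "cau_list l a b ?ps"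
    using \<sigma>(1) assms qs(1) by (simp add: cau_list_def sorted_wrt_iff_nth_less)
  then show thesis
    using that[of ?ps] qs by simp
qed

text \<open>By the triangle inequality a chain is at least as long as a path that visits some of its points
  in order. The points of \<open>xs\<close> are visited in order since the arrival times strictly increase.\<close>

lemma path_length_le_if_clocked_subset:
  assumes ps: "cau_list l a b ps" and xs: "xs \<noteq> []" "set xs \<subseteq> M"
    and neq: "\<And>i. Suc i < length xs \<Longrightarrow> xs ! i \<noteq> xs ! Suc i"
    and sub: "set (clocked d xs) \<subseteq> set ps"
  shows "path_length d xs \<le> path_length d (map fst ps)"
proof -
  let ?E = "elapsed d (map fst ps)"
  have fstM: "set (map fst ps) \<subseteq> M"
    using ps by (auto simp: cau_list_def Cau_def)
  have "\<forall>i<length xs. \<exists>k<length ps. ps ! k = (xs ! i, elapsed d xs i)"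
  proof (intro allI impI)
    fix i assume "i < length xs"
    then have "(xs ! i, elapsed d xs i) \<in> set ps"
      using sub nth_mem[of i "clocked d xs"] by auto
    then show "\<exists>k<length ps. ps ! k = (xs ! i, elapsed d xs i)"
      by (simp add: in_set_conv_nth)
  qed
  (* k i is the position in ps of the i-th entry of xs *)
  then obtain k where k: "\<And>i. i < length xs \<Longrightarrow> k i < length ps"
      "\<And>i. i < length xs \<Longrightarrow> ps ! k i = (xs ! i, elapsed d xs i)"
    by metis
  have time: "snd (ps ! i) \<le> snd (ps ! j)" if "i \<le> j" "j < length ps" for i j
  proof (cases "i = j")
    case False
    then have "cau_le d (ps ! i) (ps ! j)"
      using ps that by (simp add: cau_list_def sorted_wrt_iff_nth_less)
    then show ?thesis
      using nonneg[of "fst (ps ! i)" "fst (ps ! j)"] unfolding cau_le_def by linarith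
  qed simp
  have "elapsed d xs m \<le> ?E (k m) - ?E (k 0)" if "m < length xs" for m
    using that
  proof (induction m)
    case (Suc m)
    have "xs ! m \<in> M" "xs ! Suc m \<in> M"
      using xs(2) Suc.prems by (auto simp: subset_iff)
    then have "d (xs ! m) (xs ! Suc m) \<noteq> 0"
      using neq[OF Suc.prems] by simp
    then have "0 < d (xs ! m) (xs ! Suc m)"
      using nonneg[of "xs ! m" "xs ! Suc m"] by linarith
    then have "\<not> k (Suc m) \<le> k m"
      using time[of "k (Suc m)" "k m"] k[of m] k[of "Suc m"] Suc.prems by auto
    then have "d (xs ! m) (xs ! Suc m) \<le> ?E (k (Suc m)) - ?E (k m)"
      using dist_le_elapsed[OF fstM, of "k m" "k (Suc m)"] k[of m] k[of "Suc m"] Suc.prems by simp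
    then show ?case
      using Suc by simp
  qed simp
  then have "elapsed d xs (length xs - 1) \<le> ?E (k (length xs - 1)) - ?E (k 0)"
    using xs(1) by simp
  moreover have "0 \<le> ?E (k 0)"
    using elapsed_mono[of 0 "k 0" "map fst ps"] by simp
  moreover have "?E (k (length xs - 1)) \<le> ?E (length ps - 1)"
  proof (rule elapsed_mono)
    show "k (length xs - 1) \<le> length ps - 1"
      using k(1)[of "length xs - 1"] xs(1) by (cases xs) auto
  qed
  ultimately show ?thesis
    by (simp add: path_length_eq_elapsed)
qed

section \<open>The comparison map\<close>

text \<open>The first component names the summand of the coproduct over pairs of endpoints.\<close>

definition vertices :: "'a list \<Rightarrow> (('a \<times> 'a) \<times> 'a \<times> real) list" where
  "vertices xs = map (Pair (hd xs, last xs)) (clocked d xs)"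

definition compare_point ::
  "real \<Rightarrow> nat \<times> 'a list option \<times> (nat \<Rightarrow> real) \<Rightarrow> (('a \<times> 'a) \<times> 'a \<times> real \<Rightarrow> real) option" where
  "compare_point l p =
     (case p of (n, s, t) \<Rightarrow>
        (case s of
           None \<Rightarrow> None
         | Some xs \<Rightarrow> collapse (complex_carrier (\<Delta>'Cau M d l)) (barycentric (vertices xs) t)))"

lemma compare_point_None [simp]: "compare_point l (n, None, t) = None"
  by (simp add: compare_point_def)

lemma compare_point_Some [simp]:
  "compare_point l (n, Some xs, t) =
     collapse (complex_carrier (\<Delta>'Cau M d l)) (barycentric (vertices xs) t)"
  by (simp add: compare_point_def)

lemma length_vertices [simp]: "length (vertices xs) = length xs"
  by (simp add: vertices_def)

lemma nth_vertices [simp]: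
  "i < length xs \<Longrightarrow> vertices xs ! i = ((hd xs, last xs), xs ! i, elapsed d xs i)"
  by (simp add: vertices_def)

lemma vertices_map_fst:
  assumes "cau_list l a b ps" "path_length d (map fst ps) = l"
  shows "vertices (map fst ps) = map (Pair (a, b)) ps"
  unfolding vertices_def clocked_map_fst[OF assms] ..

lemma labelled_in_\<Delta>Cau:
  assumes "cau_list l a b ps"
  shows "set (map (Pair (a, b)) ps) \<in> \<Delta>Cau M d l"
proof -
  have "(a, b) \<in> M \<times> M"
    using assms by (simp add: cau_list_def)
  then show ?thesis
    using set_cau_list_in_\<Delta>Cau_ab[OF assms] unfolding \<Delta>Cau_def coprod_complex_def by fastforce
qed

lemma labelled_in_\<Delta>'Cau:
  assumes "cau_list l a b ps" "path_length d (map fst ps) < l"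
  shows "set (map (Pair (a, b)) ps) \<in> \<Delta>'Cau M d l"
proof -
  have "(a, b) \<in> M \<times> M"
    using assms by (simp add: cau_list_def)
  then show ?thesis
    using set_cau_list_in_\<Delta>'Cau_ab[OF assms] unfolding \<Delta>'Cau_def coprod_complex_def by fastforce
qed

lemma short_barycentric_in_\<Delta>'Cau:
  assumes "cau_list l a b ps" "path_length d (map fst ps) < l"
    and "length ps = Suc n" "t \<in> standard_simplex n"
  shows "barycentric (map (Pair (a, b)) ps) t \<in> complex_carrier (\<Delta>'Cau M d l)"
  using labelled_in_\<Delta>'Cau[OF assms(1,2)] barycentric_in_closed_simplex[of "map (Pair (a, b)) ps" n t]
    assms(3,4)
  unfolding complex_carrier_def by auto

abbreviation HW :: "real \<Rightarrow> 'a list option simplicial_set" where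
  "HW \<equiv> hw_simplicial_set M d"

abbreviation TY :: "real \<Rightarrow> (('a \<times> 'a) \<times> 'a \<times> real \<Rightarrow> real) option topology" where
  "TY \<equiv> magnitude_homotopy_type M d"

lemma None_in_HW [simp]: "None \<in> simplices (HW l) n"
  by (simp add: hw_simplicial_set_def hw_simplices_def)

lemma Some_in_HW [simp]:
  "Some xs \<in> simplices (HW l) n \<longleftrightarrow> length xs = Suc n \<and> set xs \<subseteq> M \<and> path_length d xs = l"
  by (auto simp: hw_simplicial_set_def hw_simplices_def)

lemma face_HW_None [simp]: "face (HW l) n i None = None"
  by (simp add: hw_simplicial_set_def hw_face_def)

lemma face_HW_Some:
  "face (HW l) n i (Some xs) =
     (if path_length d (delete_nth i xs) = l then Some (delete_nth i xs) else None)"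
  by (simp add: hw_simplicial_set_def hw_face_def)

lemma degen_HW [simp]: "degen (HW l) n i = map_option (repeat_nth i)"
  by (simp add: hw_simplicial_set_def)

lemma cau_list_of_simplex:
  assumes "Some xs \<in> simplices (HW l) n"
  shows "cau_list l (hd xs) (last xs) (clocked d xs)"
  using assms by (intro cau_list_clocked) auto

lemma continuous_map_compare_point:
  "continuous_map (sset_prerealization (HW l)) (TY l) (compare_point l)"
proof (rule continuous_map_from_sset_prerealization)
  fix n s assume s: "s \<in> simplices (HW l) n"
  show "continuous_map (subtopology (powertop_real UNIV) (standard_simplex n)) (TY l)
          (\<lambda>t. compare_point l (n, s, t))"
  proof (cases s)
    case None
    then show ?thesis
      by (simp add: magnitude_homotopy_type_def topspace_collapse_topology)
  next
    case (Some xs)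
    have "set (vertices xs) \<in> \<Delta>Cau M d l"
      using labelled_in_\<Delta>Cau[OF cau_list_of_simplex] s Some unfolding vertices_def by blast
    then have "continuous_map (subtopology (powertop_real UNIV) (standard_simplex n))
        (complex_realization (\<Delta>Cau M d l)) (barycentric (vertices xs))"
      using s Some by (intro continuous_map_barycentric) auto
    from continuous_map_compose[OF this continuous_map_collapse]
    show ?thesis
      using Some by (simp add: magnitude_homotopy_type_def o_def)
  qed
qed

text \<open>Deleting an entry of the clocked list leaves a causal list. If its length is still \<open>l\<close>, rigidity
  identifies it with the clocked list of the face. Otherwise its length is below \<open>l\<close>, and both
  sides are the collapsed point.\<close>

lemma compare_point_face:
  assumes s: "s \<in> simplices (HW l) (Suc n)" and i: "i \<le> Suc n" and t: "t \<in> standard_simplex n"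
  shows "compare_point l (n, face (HW l) (Suc n) i s, t) =
         compare_point l (Suc n, s, simplical_face i t)"
proof (cases s)
  case (Some xs)
  have xs: "length xs = Suc (Suc n)" "cau_list l (hd xs) (last xs) (clocked d xs)"
    using s cau_list_of_simplex Some by auto
  let ?qs = "delete_nth i (clocked d xs)"
  have len: "length ?qs = Suc n"
    using i xs(1) by (simp add: length_delete_nth)
  have qs: "cau_list l (hd xs) (last xs) ?qs"
    using xs(2) by (rule cau_list_delete_nth) (use len in auto)
  have fst: "map fst ?qs = delete_nth i xs"
    by (simp add: map_delete_nth)
  have bary: "barycentric (vertices xs) (simplical_face i t) =
      barycentric (map (Pair (hd xs, last xs)) ?qs) t"
    using i xs(1) by (subst barycentric_face) (simp_all add: vertices_def map_delete_nth)
  show ?thesis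
  proof (cases "path_length d (delete_nth i xs) = l")
    case True
    then show ?thesis
      using vertices_map_fst[OF qs] bary Some by (simp add: face_HW_Some fst)
  next
    case False
    then have "path_length d (map fst ?qs) < l"
      using path_length_le[OF qs] fst by simp
    then have "barycentric (vertices xs) (simplical_face i t) \<in> complex_carrier (\<Delta>'Cau M d l)"
      unfolding bary by (rule short_barycentric_in_\<Delta>'Cau[OF qs _ len t])
    then show ?thesis
      using False Some by (simp add: face_HW_Some collapse_def)
  qed
qed simp

text \<open>Repeating an entry takes no time, and the weights of the two copies merge.\<close>

lemma compare_point_degen:
  assumes s: "s \<in> simplices (HW l) n" and i: "i \<le> n"
  shows "compare_point l (Suc n, degen (HW l) n i s, t) =
         compare_point l (n, s, simplicial_degen i t)"
proof (cases s)
  case (Some xs)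
  have xs: "length xs = Suc n" "set xs \<subseteq> M" "path_length d xs = l"
      "cau_list l (hd xs) (last xs) (clocked d xs)"
    using s cau_list_of_simplex Some by auto
  let ?qs = "repeat_nth i (clocked d xs)"
  have "cau_list l (hd xs) (last xs) ?qs"
    using xs i by (intro cau_list_repeat_nth) auto
  moreover have fst: "map fst ?qs = repeat_nth i xs"
    by (simp add: map_repeat_nth)
  moreover have "path_length d (repeat_nth i xs) = l"
    using path_length_repeat_nth[OF xs(2)] xs i by simp
  ultimately have "vertices (repeat_nth i xs) = map (Pair (hd xs, last xs)) ?qs"
    using vertices_map_fst by metis
  also have "\<dots> = repeat_nth i (vertices xs)"
    by (simp add: vertices_def map_repeat_nth)
  finally show ?thesis
    using Some i xs(1) by (simp add: barycentric_degen)
qed simp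

lemma compare_point_equivclp_glue:
  assumes "equivclp (glue (HW l)) p q"
  shows "compare_point l p = compare_point l q"
proof -
  have "compare_point l p = compare_point l q" if "glue (HW l) p q" for p q
    using that
  proof cases
    case glue_face
    then show ?thesis using compare_point_face by blast
  next
    case glue_degen
    then show ?thesis using compare_point_degen by blast
  qed
  with assms show ?thesis
    by (induction rule: equivclp_induct) auto
qed

section \<open>Normal forms\<close>

text \<open>The points interior to a nondegenerate simplex. Over the base point only dimension zero
  qualifies, as all higher simplices there are degenerate.\<close>

definition normal_point :: "real \<Rightarrow> nat \<times> 'a list option \<times> (nat \<Rightarrow> real) \<Rightarrow> bool" where
  "normal_point l p \<longleftrightarrow>
     (\<exists>t. p = (0, None, t) \<and> t \<in> standard_simplex 0) \<or>
     (\<exists>n xs t. p = (n, Some xs, t) \<and> Some xs \<in> simplices (HW l) n \<and> t \<in> standard_simplex n \<and>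
        (\<forall>i\<le>n. t i \<noteq> 0) \<and> (\<forall>i<n. xs ! i \<noteq> xs ! Suc i))"

text \<open>Any defect lowers the dimension: a vanishing coordinate is removed by a face gluing, a
  repetition (or the base point in positive dimension) by a degeneracy gluing.\<close>

lemma glue_normal_point_exists:
  assumes "s \<in> simplices (HW l) n" "t \<in> standard_simplex n"
  shows "\<exists>q. equivclp (glue (HW l)) (n, s, t) q \<and> normal_point l q"
  using assms
proof (induction n arbitrary: s t)
  case 0
  show ?case
  proof (cases s)
    case None
    then show ?thesis
      using 0 by (intro exI[of _ "(0, s, t)"]) (auto simp: normal_point_def)
  next
    case (Some xs)
    have "t 0 \<noteq> 0"
      using 0 by (simp add: standard_simplex_def)
    then show ?thesis
      using 0 Some by (intro exI[of _ "(0, s, t)"]) (auto simp: normal_point_def)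
  qed
next
  case (Suc n)
  have reduce: ?case
    if "glue (HW l) (Suc n, s, t) (n, s', t') \<or> glue (HW l) (n, s', t') (Suc n, s, t)"
      "s' \<in> simplices (HW l) n" "t' \<in> standard_simplex n" for s' t'
  proof -
    have "equivclp (glue (HW l)) (Suc n, s, t) (n, s', t')"
      using that(1) by (metis equivclp_sym r_into_equivclp)
    then show ?thesis
      using Suc.IH[OF that(2,3)] by (meson equivclp_trans)
  qed
  show ?case
  proof (cases s)
    case None
    have "glue (HW l) (Suc n, degen (HW l) n 0 None, t) (n, None, simplicial_degen 0 t)"
      using Suc.prems by (intro glue_degen) auto
    then show ?thesis
      using None Suc.prems
      by (intro reduce[of None "simplicial_degen 0 t"]) (auto intro: simplicial_degen_in_standard_simplex)
  next
    case (Some xs)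
    have xs: "length xs = Suc (Suc n)" "set xs \<subseteq> M" "path_length d xs = l"
      using Suc.prems Some by auto
    consider i where "i \<le> Suc n" "t i = 0" | i where "i < Suc n" "xs ! i = xs ! Suc i"
      | "normal_point l (Suc n, s, t)"
      using Some Suc.prems unfolding normal_point_def by blast
    then show ?thesis
    proof cases
      case (1 i)
      then obtain u where u: "u \<in> standard_simplex n" "t = simplical_face i u"
        using standard_simplex_zero_is_face Suc.prems(2) by metis
      have "face (HW l) (Suc n) i s \<in> simplices (HW l) n"
        using xs 1 set_delete_nth_subset[of i xs] unfolding Some face_HW_Some
        by (auto simp: length_delete_nth)
      moreover have "glue (HW l) (n, face (HW l) (Suc n) i s, u) (Suc n, s, t)"
        unfolding u(2) using Suc.prems(1) 1(1) u(1) by (rule glue_face)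
      ultimately show ?thesis
        using u(1) reduce by blast
    next
      case (2 i)
      let ?ys = "delete_nth i xs"
      have rep: "repeat_nth i ?ys = xs"
        using 2 xs by (intro repeat_delete_nth) auto
      have len: "length ?ys = Suc n"
        using 2 xs by (simp add: length_delete_nth)
      have ys: "Some ?ys \<in> simplices (HW l) n"
        using path_length_repeat_nth[of ?ys i] set_delete_nth_subset[of i xs] 2 xs rep len by auto
      have "glue (HW l) (Suc n, degen (HW l) n i (Some ?ys), t) (n, Some ?ys, simplicial_degen i t)"
        using ys 2 Suc.prems by (intro glue_degen) auto
      then have glued: "glue (HW l) (Suc n, s, t) (n, Some ?ys, simplicial_degen i t)"
        unfolding Some by (simp only: degen_HW option.map rep)
      have "simplicial_degen i t \<in> standard_simplex n"
        using 2 Suc.prems(2) by (intro simplicial_degen_in_standard_simplex) auto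
      then show ?thesis
        by (rule reduce[OF disjI1[OF glued] ys])
    next
      case 3
      then show ?thesis
        by (intro exI[of _ "(Suc n, s, t)"] conjI equivclp_refl)
    qed
  qed
qed

lemma elapsed_strict_mono:
  assumes "set xs \<subseteq> M" "\<And>i. Suc i < length xs \<Longrightarrow> xs ! i \<noteq> xs ! Suc i" "i < j" "j < length xs"
  shows "elapsed d xs i < elapsed d xs j"
proof -
  have "xs ! i \<in> M" "xs ! Suc i \<in> M" "xs ! i \<noteq> xs ! Suc i"
    using assms by (auto simp: subset_iff)
  then have "0 < d (xs ! i) (xs ! Suc i)"
    using nonneg[of "xs ! i" "xs ! Suc i"] zero by fastforce
  then show ?thesis
    using elapsed_mono[of "Suc i" j xs] assms(3) by simp
qed

text \<open>For a nondegenerate tuple the arrival times strictly increase, so the vertices are distinct and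
  are exactly the support of an interior point.\<close>

context
  fixes l n xs t
  assumes xs: "Some xs \<in> simplices (HW l) n" and t: "t \<in> standard_simplex n"
    and pos: "\<forall>i\<le>n. t i \<noteq> 0" and neq: "\<forall>i<n. xs ! i \<noteq> xs ! Suc i"
begin

lemma sorted_clocked_normal:
  "sorted (map snd (clocked d xs))" "distinct (map snd (clocked d xs))"
proof -
  have "elapsed d xs i < elapsed d xs j" if "i < j" "j < length xs" for i j
    using elapsed_strict_mono that xs neq by auto
  then have "sorted_wrt (<) (map snd (clocked d xs))"
    by (simp add: sorted_wrt_iff_nth_less)
  then show "sorted (map snd (clocked d xs))" "distinct (map snd (clocked d xs))"
    by (simp_all add: strict_sorted_iff)
qed

lemma distinct_vertices_normal: "distinct (vertices xs)"
proof -
  have "distinct (clocked d xs)"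
    using sorted_clocked_normal(2) by (simp add: distinct_map)
  then show ?thesis
    by (simp add: vertices_def distinct_map inj_on_def)
qed

lemma support_normal: "barycentric (vertices xs) t v \<noteq> 0 \<longleftrightarrow> v \<in> set (vertices xs)"
proof
  assume "v \<in> set (vertices xs)"
  then obtain i where "i < length xs" "v = vertices xs ! i"
    by (metis in_set_conv_nth length_vertices)
  then show "barycentric (vertices xs) t v \<noteq> 0"
    using barycentric_nth[OF distinct_vertices_normal, of i t] pos xs by auto
qed (metis barycentric_outside)

text \<open>A simplex carrying an interior point contains all its vertices, hence all of a path of length
  \<open>l\<close>; by the triangle inequality it is not shorter.\<close>

lemma normal_not_in_\<Delta>'Cau: "barycentric (vertices xs) t \<notin> complex_carrier (\<Delta>'Cau M d l)"
proof
  assume "barycentric (vertices xs) t \<in> complex_carrier (\<Delta>'Cau M d l)"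
  then obtain a b \<sigma> where \<sigma>: "a \<in> M" "b \<in> M" "\<sigma> \<in> \<Delta>'Cau_ab M d l a b"
      "barycentric (vertices xs) t \<in> closed_simplex (Pair (a, b) ` \<sigma>)"
    unfolding complex_carrier_def \<Delta>'Cau_def coprod_complex_def by auto
  then obtain ps where ps: "set ps = \<sigma>" "sorted_wrt (\<lambda>p q. cau_le d p q \<and> p \<noteq> q) ps"
      "path_length d (map fst ps) < l" "\<sigma> \<in> \<Delta>Cau_ab M d l a b"
    unfolding \<Delta>'Cau_ab_def by auto
  have "cau_list l a b ps"
    using ps \<sigma> by (auto simp: cau_list_def \<Delta>Cau_ab_def order_complex_def sorted_wrt_iff_nth_less)
  moreover have "set (clocked d xs) \<subseteq> set ps"
  proof
    fix p assume "p \<in> set (clocked d xs)"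
    then have "((hd xs, last xs), p) \<in> set (vertices xs)"
      by (simp add: vertices_def)
    then have "((hd xs, last xs), p) \<in> Pair (a, b) ` \<sigma>"
      using support_normal \<sigma>(4) unfolding closed_simplex_def by blast
    then show "p \<in> set ps"
      using ps(1) by auto
  qed
  ultimately have "path_length d xs \<le> path_length d (map fst ps)"
    using xs neq by (intro path_length_le_if_clocked_subset) auto
  then show False
    using ps(3) xs by simp
qed

end

text \<open>The support of the image is the set of clocked vertices. Sorting it by time recovers the tuple,
  and the values at the vertices recover the coordinates.\<close>

lemma compare_point_inj_normal:
  assumes "normal_point l p" "normal_point l q" and eq: "compare_point l p = compare_point l q"
  shows "p = q"
proof -
  have base: "t = u" if "t \<in> standard_simplex 0" "u \<in> standard_simplex 0" for t u
  proof
    fix i show "t i = u i"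
      using that by (cases i) (simp_all add: standard_simplex_def)
  qed
  have not_None: "compare_point l (n, Some xs, t) = Some (barycentric (vertices xs) t)"
    if "Some xs \<in> simplices (HW l) n" "t \<in> standard_simplex n"
      "\<forall>i\<le>n. t i \<noteq> 0" "\<forall>i<n. xs ! i \<noteq> xs ! Suc i" for n xs t
    using normal_not_in_\<Delta>'Cau[OF that] by (simp add: collapse_def)
  have "(n, xs, t) = (m, ys, u)"
    if xs: "Some xs \<in> simplices (HW l) n" "t \<in> standard_simplex n"
      "\<forall>i\<le>n. t i \<noteq> 0" "\<forall>i<n. xs ! i \<noteq> xs ! Suc i"
      and ys: "Some ys \<in> simplices (HW l) m" "u \<in> standard_simplex m"
      "\<forall>i\<le>m. u i \<noteq> 0" "\<forall>i<m. ys ! i \<noteq> ys ! Suc i"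
      and bary: "barycentric (vertices xs) t = barycentric (vertices ys) u" for n xs t m ys u
  proof -
    have verts: "set (vertices xs) = set (vertices ys)"
      using support_normal[OF xs] support_normal[OF ys] bary by auto
    have "snd ` set (vertices zs) = set (clocked d zs)" for zs
      by (simp add: vertices_def image_image)
    then have "set (clocked d xs) = set (clocked d ys)"
      using verts by metis
    moreover have "inj_on snd (set (clocked d xs) \<union> set (clocked d ys))"
      using calculation sorted_clocked_normal(2)[OF xs] by (simp add: distinct_map)
    ultimately have "clocked d xs = clocked d ys"
      using sorted_clocked_normal[OF xs] sorted_clocked_normal[OF ys]
      by (intro map_sorted_distinct_set_unique[of snd])
    then have same: "xs = ys"
      by (metis map_fst_clocked)
    then have "n = m"
      using xs(1) ys(1) by simp
    moreover have "t i = u i" for i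
    proof (cases "i \<le> n")
      case True
      then show ?thesis
        using barycentric_nth[OF distinct_vertices_normal[OF xs], of i] xs(1) bary same by (metis
            Some_in_HW length_vertices less_Suc_eq_le)
    next
      case False
      then show ?thesis
        using xs(2) ys(2) \<open>n = m\<close> by (simp add: standard_simplex_def)
    qed
    ultimately show ?thesis
      using same by auto
  qed
  note simplices = this
  show ?thesis
  proof (cases "fst (snd p)")
    case None
    then obtain t where p: "p = (0, None, t)" "t \<in> standard_simplex 0"
      using assms(1) unfolding normal_point_def by auto
    then have "compare_point l q = None"
      using eq by simp
    then obtain u where "q = (0, None, u)" "u \<in> standard_simplex 0"
      using assms(2) not_None unfolding normal_point_def by fastforce
    then show ?thesis
      using p base by simp
  next
    case (Some xs)
    then obtain n t where p: "p = (n, Some xs, t)" "Some xs \<in> simplices (HW l) n"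
        "t \<in> standard_simplex n" "\<forall>i\<le>n. t i \<noteq> 0" "\<forall>i<n. xs ! i \<noteq> xs ! Suc i"
      using assms(1) unfolding normal_point_def by auto
    then have some: "compare_point l q = Some (barycentric (vertices xs) t)"
      using not_None[OF p(2-5)] eq by (simp only:)
    then obtain m ys u where q: "q = (m, Some ys, u)" "Some ys \<in> simplices (HW l) m"
        "u \<in> standard_simplex m" "\<forall>i\<le>m. u i \<noteq> 0" "\<forall>i<m. ys ! i \<noteq> ys ! Suc i"
      using assms(2) unfolding normal_point_def by fastforce
    have "barycentric (vertices xs) t = barycentric (vertices ys) u"
      using some not_None[OF q(2-5)] unfolding q(1) by (simp only: option.inject)
    then show ?thesis
      using simplices[OF p(2-5) q(2-5)] p(1) q(1) by simp
  qed
qed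

lemma compare_point_eq_iff:
  assumes "p \<in> topspace (sset_prerealization (HW l))" "q \<in> topspace (sset_prerealization (HW l))"
  shows "compare_point l p = compare_point l q \<longleftrightarrow> equivclp (glue (HW l)) p q"
proof
  assume eq: "compare_point l p = compare_point l q"
  have normal: "\<exists>r'. equivclp (glue (HW l)) r r' \<and> normal_point l r'"
    if "r \<in> topspace (sset_prerealization (HW l))" for r
  proof -
    obtain n s t where "r = (n, s, t)"
      by (cases r)
    then show ?thesis
      using that glue_normal_point_exists[of s l n t]
      by (simp only: topspace_sset_prerealization mem_Collect_eq case_prod_conv)
  qed
  obtain p' q' where p': "equivclp (glue (HW l)) p p'" "normal_point l p'"
    and q': "equivclp (glue (HW l)) q q'" "normal_point l q'"
    using normal assms by meson
  have "p' = q'"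
    using compare_point_inj_normal[OF p'(2) q'(2)] compare_point_equivclp_glue p'(1) q'(1) eq by metis
  then show "equivclp (glue (HW l)) p q"
    using p' q' by (metis equivclp_sym equivclp_trans)
qed (rule compare_point_equivclp_glue)

section \<open>Lifting closed simplices of causal chains\<close>

text \<open>List the chain in increasing order and read off the coordinates in that order, over the tuple if
  its length is \<open>l\<close> and over the base point if it is shorter. The underlying simplex is constant on
  the closed simplex, so continuity is that of the coordinates.\<close>

lemma closed_simplex_lift:
  assumes "\<sigma> \<in> \<Delta>Cau M d l"
  shows "\<exists>e. continuous_map (subtopology (powertop_real UNIV) (closed_simplex \<sigma>))
               (sset_prerealization (HW l)) e \<and>
             (\<forall>f\<in>closed_simplex \<sigma>.
                compare_point l (e f) = collapse (complex_carrier (\<Delta>'Cau M d l)) f)"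
proof -
  obtain a b \<tau> where ab: "a \<in> M" "b \<in> M" "\<tau> \<in> \<Delta>Cau_ab M d l a b" "\<sigma> = Pair (a, b) ` \<tau>"
    using assms unfolding \<Delta>Cau_def coprod_complex_def by auto
  then obtain ps where ps: "cau_list l a b ps" "distinct ps" "set ps = \<tau>"
    using \<Delta>Cau_ab_cases by metis
  define vs where "vs = map (Pair (a, b)) ps"
  define n where "n = length ps - 1"
  have len: "length vs = Suc n" "length ps = Suc n"
    using ps(1) by (auto simp: vs_def n_def cau_list_def)
  have vs: "set vs = \<sigma>" "distinct vs"
    using ps ab(4) by (auto simp: vs_def distinct_map inj_on_def)
  define coords where "coords = (\<lambda>(f :: _ \<Rightarrow> real) i. if i \<le> n then f (vs ! i) else 0)"
  have coords: "coords f \<in> standard_simplex n" if f: "f \<in> closed_simplex \<sigma>" for f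
  proof (rule standard_simplexI)
    have "sum (coords f) {..n} = (\<Sum>i<length vs. f (vs ! i))"
      unfolding len lessThan_Suc_atMost by (intro sum.cong) (auto simp: coords_def)
    also have "\<dots> = sum f \<sigma>"
      unfolding vs(1)[symmetric] using vs(2)
      by (intro sum.reindex_bij_betw bij_betw_nth) auto
    finally show "sum (coords f) {..n} = 1"
      using f by (simp add: closed_simplex_def)
    have "0 \<le> f v" for v
      using f unfolding closed_simplex_def by blast
    then show "0 \<le> coords f i" for i
      unfolding coords_def by simp
  qed (simp add: coords_def)
  have bary: "barycentric vs (coords f) = f" if f: "f \<in> closed_simplex \<sigma>" for f
  proof
    fix v show "barycentric vs (coords f) v = f v"
    proof (cases "v \<in> set vs")
      case True
      then obtain i where "i < length vs" "v = vs ! i"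
        by (metis in_set_conv_nth)
      then show ?thesis
        using barycentric_nth[OF vs(2)] len by (simp add: coords_def)
    next
      case False
      then have "f v = 0"
        using f vs(1) unfolding closed_simplex_def by blast
      then show ?thesis
        using barycentric_outside[OF False] by simp
    qed
  qed
  have "continuous_map (subtopology (powertop_real UNIV) (closed_simplex \<sigma>)) euclideanreal
      (\<lambda>f. coords f i)" for i
    unfolding coords_def
    by (cases "i \<le> n") (auto intro: continuous_map_from_subtopology continuous_map_product_projection)
  then have cont: "continuous_map (subtopology (powertop_real UNIV) (closed_simplex \<sigma>))
      (subtopology (powertop_real UNIV) (standard_simplex n)) coords"
    using coords by (auto simp: continuous_map_in_subtopology continuous_map_componentwise_UNIV)
  define s where
    "s = (if path_length d (map fst ps) = l then Some (map fst ps) else None)"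
  have s: "s \<in> simplices (HW l) n"
    using ps(1) len by (auto simp: s_def cau_list_def Cau_def)
  have "compare_point l (n, s, coords f) = collapse (complex_carrier (\<Delta>'Cau M d l)) f"
    if f: "f \<in> closed_simplex \<sigma>" for f
  proof (cases "path_length d (map fst ps) = l")
    case True
    then show ?thesis
      using vertices_map_fst[OF ps(1)] bary[OF f] by (simp add: s_def vs_def)
  next
    case False
    then have "path_length d (map fst ps) < l"
      using path_length_le[OF ps(1)] by simp
    then have "f \<in> complex_carrier (\<Delta>'Cau M d l)"
      using short_barycentric_in_\<Delta>'Cau[OF ps(1) _ len(2) coords[OF f]] bary[OF f]
      by (simp add: vs_def)
    then show ?thesis
      using False by (simp add: s_def collapse_def)
  qed
  then show ?thesis
    using continuous_map_into_sset_prerealization[OF s cont] by blast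
qed

lemma quotient_map_compare_point:
  "quotient_map (sset_prerealization (HW l)) (TY l) (compare_point l)"
  unfolding magnitude_homotopy_type_def
proof (rule quotient_map_onto_collapsed_complex)
  show "continuous_map (sset_prerealization (HW l))
      (collapse_topology (complex_realization (\<Delta>Cau M d l)) (complex_carrier (\<Delta>'Cau M d l)))
      (compare_point l)"
    using continuous_map_compare_point by (simp add: magnitude_homotopy_type_def)
  have "(\<lambda>i. if i = 0 then 1 else 0) \<in> standard_simplex 0"
    by (simp add: standard_simplex_def)
  then show "None \<in> compare_point l ` topspace (sset_prerealization (HW l))"
    by (intro image_eqI[of _ _ "(0, None, \<lambda>i. if i = 0 then 1 else 0)"])
      (simp_all add: topspace_sset_prerealization)
qed (rule closed_simplex_lift)

lemma magnitude_homotopy_type_homeomorphic_sset_realization: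
  "TY l homeomorphic_space sset_realization (HW l)"
  using quotient_map_compare_point quotient_map_sset_realization
  by (rule homeomorphic_space_if_quotient_maps_same_fibres)
    (simp add: glue_class_eq_iff compare_point_eq_iff)

end

theorem proposition4p1:
  fixes X :: "'a set" and d :: "'a \<Rightarrow> 'a \<Rightarrow> real" and l :: real
  assumes "Metric_space X d" and "0 \<le> l"
  shows "magnitude_homotopy_type X d l homeomorphic_space
         sset_realization (hw_simplicial_set X d l)"
  using assms(1) by (rule Metric_space.magnitude_homotopy_type_homeomorphic_sset_realization)

end
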